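(* For every program $P$, state $s$ and natural number $n$, $$\mathrm{conv}\,F_n(P,s)=\{\mu\mid \langle P,s\rangle\Downarrow^{\mathcal S,n}\mu\ \text{for some scheduler }\mathcal S\},$$ where $\mathrm{conv}$ denotes the convex hull (set of finite convex combinations).
   Context: Fix a set $S$ of states. For a set $X$, $\mathcal V_{=1,\omega}(X)$ (resp. $\mathcal V_{\le1,\omega}(X)$) is the set of finitely supported probability (resp. subprobability) distributions on $X$, written as finite formal sums $\sum_i p_i\cdot x_i$; $\bot$ is the zero distribution and $1\cdot x=\delta_x$ the point mass; ordered, added and scaled pointwise. For each atomic program $\mathtt a$ a function $[\![\mathtt a]\!]:S\to\mathcal V_{=1,\omega}(S)$ is given, and for each condition $\mathtt b$ a function $[\![\mathtt b]\!]:S\to\{\mathtt{tt},\mathtt{ff}\}$. Programs: $P::=\mathtt{skip}\mid\mathtt a\mid P;P\mid P\parallel P\mid P+_{\mathtt p}P\mid P+P\mid\mathtt{if}\ \mathtt b\ \mathtt{then}\ P\ \mathtt{else}\ P\mid\mathtt{while}\ \mathtt b\ P$ ($\mathtt p\in[0,1]\cap\mathbb Q$). The small-step relation $\longrightarrow\subseteq(\mathrm{Pr}\times S)\times\mathcal V_{=1,\omega}(S+\mathrm{Pr}\times S)$ is the least relation closed under: $\langle\mathtt a,s\rangle\to[\![\mathtt a]\!](s)$; $\langle\mathtt{skip},s\rangle\to1\cdot s$; if $\langle P,s\rangle\to\sum_ip_i\langle P_i,s_i\rangle+\sum_jp_j s_j$ then $\langle P;Q,s\rangle\to\sum_ip_i\langle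 P_i;Q,s_i\rangle+\sum_jp_j\langle Q,s_j\rangle$ and $\langle P\parallel Q,s\rangle\to\sum_ip_i\langle P_i\parallel Q,s_i\rangle+\sum_jp_j\langle Q,s_j\rangle$; if $\langle Q,s\rangle\to\sum_ip_i\langle Q_i,s_i\rangle+\sum_jp_js_j$ then $\langle P\parallel Q,s\rangle\to\sum_ip_i\langle P\parallel Q_i,s_i\rangle+\sum_jp_j\langle P,s_j\rangle$; if $\langle P,s\rangle\to\mu$ and $\langle Q,s\rangle\to\nu$ then $\langle P+_{\mathtt p}Q,s\rangle\to\mathtt p\cdot\mu+(1-\mathtt p)\cdot\nu$; if $\langle P,s\rangle\to\mu$ or $\langle Q,s\rangle\to\mu$ then $\langle P+Q,s\rangle\to\mu$; $\langle\mathtt{if}\ \mathtt b\ \mathtt{then}\ P\ \mathtt{else}\ Q,s\rangle\to1\cdot\langle P,s\rangle$ if $[\![\mathtt b]\!](s)=\mathtt{tt}$, $\to1\cdot\langle Q,s\rangle$ otherwise; $\langle\mathtt{while}\ \mathtt b\ P,s\rangle\to1\cdot\langle P;\mathtt{while}\ \mathtt b\ P,s\rangle$ if $[\![\mathtt b]\!](s)=\mathtt{tt}$, $\to1\cdot s$ otherwise. Write $\langle P,s\rangle\!\longrightarrow=\{\mu\mid\langle P,s\rangle\to\mu\}$. Let $I=((\mathrm{Pr}\times S)\times\mathcal V_{=1,\omega}(S+\mathrm{Pr}\times S))^*\times(\mathrm{Pr}\times S)$, elements written $h\langle P,s\rangle$ ($h$ a history; juxtaposition extends histories). A scheduler is a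 partial function $\mathcal S:I\rightharpoonup\mathcal V_{=1,\omega}(S+\mathrm{Pr}\times S)$ whose value at $h\langle P,s\rangle$, when defined, is a finite convex combination of elements of $\langle P,s\rangle\!\longrightarrow$. Big-step: $h\langle P,s\rangle\Downarrow^{\mathcal S,0}\bot$; and $h\langle P,s\rangle\Downarrow^{\mathcal S,n+1}\sum_kp_k(\sum_ip_{k,i}\mu_{k,i}+\sum_jp_{k,j}s_{k,j})$ whenever $\mathcal S(h\langle P,s\rangle)=\sum_kp_k\nu_k$ with $\nu_k=\sum_ip_{k,i}\langle P_{k,i},s_{k,i}\rangle+\sum_jp_{k,j}s_{k,j}\in\langle P,s\rangle\!\longrightarrow$ and $h\langle P,s\rangle\nu_k\langle P_{k,i},s_{k,i}\rangle\Downarrow^{\mathcal S,n}\mu_{k,i}$ for all $k,i$; with empty history we write $\langle P,s\rangle\Downarrow^{\mathcal S,n}\mu$. Finite sets $F_n(P,s)\subseteq\mathcal V_{\le1,\omega}(S)$ are defined by $F_0(P,s)=\{\bot\}$ and $F_{n+1}(P,s)=\bigcup\{\sum_ip_i\cdot F_n(P_i,s_i)+\sum_jp_j\cdot\delta_{s_j}\mid\langle P,s\rangle\to\sum_ip_i\langle P_i,s_i\rangle+\sum_jp_js_j\}$, with Minkowski sums and scalings of sets. *)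

theory Defs
  imports Complex_Main
begin

(* Finitely supported (sub)probability distributions on a set X are represented
   as functions X => real; "\<bottom>" is the constant 0 function. *)

type_synonym 'x dist = "'x \<Rightarrow> real"

definition supp :: "'x dist \<Rightarrow> 'x set" where
  "supp d = {x. d x \<noteq> 0}"

(* V_{=1,omega}(X) *)
definition is_dist :: "'x dist \<Rightarrow> bool" where
  "is_dist d \<longleftrightarrow> (\<forall>x. 0 \<le> d x) \<and> finite (supp d) \<and> sum d (supp d) = 1"

(* V_{<=1,omega}(X) *)
definition is_subdist :: "'x dist \<Rightarrow> bool" where
  "is_subdist d \<longleftrightarrow> (\<forall>x. 0 \<le> d x) \<and> finite (supp d) \<and> sum d (supp d) \<le> 1"

definition zero_dist :: "'x dist" where
  "zero_dist = (\<lambda>_. 0)"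

definition point :: "'x \<Rightarrow> 'x dist" where
  "point x = (\<lambda>y. if y = x then 1 else 0)"

(* pushforward of a finitely supported distribution (formal sums add up) *)
definition push :: "('x \<Rightarrow> 'y) \<Rightarrow> 'x dist \<Rightarrow> 'y dist" where
  "push f d = (\<lambda>y. sum d {x \<in> supp d. f x = y})"

(* conv A: the set of finite convex combinations of elements of A *)
definition conv :: "'x dist set \<Rightarrow> 'x dist set" where
  "conv A = {\<mu>. \<exists>(m::nat) (p::nat \<Rightarrow> real) (x::nat \<Rightarrow> 'x dist).
      (\<forall>i<m. 0 \<le> p i \<and> x i \<in> A) \<and> sum p {..<m} = 1 \<and>
      \<mu> = (\<lambda>t. \<Sum>i<m. p i * x i t)}"

(* Programs; 'a = atomic programs, 'b = conditions *)
datatype ('a, 'b) prog =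
    Skip
  | Atom 'a
  | Seq "('a, 'b) prog" "('a, 'b) prog"
  | Par "('a, 'b) prog" "('a, 'b) prog"
  | PChoice "('a, 'b) prog" rat "('a, 'b) prog"   (* P +_p Q *)
  | NChoice "('a, 'b) prog" "('a, 'b) prog"       (* P + Q *)
  | If 'b "('a, 'b) prog" "('a, 'b) prog"
  | While 'b "('a, 'b) prog"

(* probabilities p in [0,1] \<inter> Q *)
fun wf_prog :: "('a, 'b) prog \<Rightarrow> bool" where
  "wf_prog Skip = True"
| "wf_prog (Atom a) = True"
| "wf_prog (Seq P Q) = (wf_prog P \<and> wf_prog Q)"
| "wf_prog (Par P Q) = (wf_prog P \<and> wf_prog Q)"
| "wf_prog (PChoice P p Q) = (0 \<le> p \<and> p \<le> 1 \<and> wf_prog P \<and> wf_prog Q)"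
| "wf_prog (NChoice P Q) = (wf_prog P \<and> wf_prog Q)"
| "wf_prog (If b P Q) = (wf_prog P \<and> wf_prog Q)"
| "wf_prog (While b P) = wf_prog P"

type_synonym ('a, 'b, 's) conf = "('a, 'b) prog \<times> 's"
type_synonym ('a, 'b, 's) res = "('s + ('a, 'b) prog \<times> 's) dist"

definition embed_state :: "'s dist \<Rightarrow> ('a, 'b, 's) res" where
  "embed_state d = (\<lambda>x. case x of Inl t \<Rightarrow> d t | Inr _ \<Rightarrow> 0)"

(* continuation maps used by the rules for ; and || *)
fun seq_map :: "('a, 'b) prog \<Rightarrow> 's + ('a, 'b) prog \<times> 's \<Rightarrow> 's + ('a, 'b) prog \<times> 's" where
  "seq_map Q (Inr (P', s')) = Inr (Seq P' Q, s')"
| "seq_map Q (Inl s') = Inr (Q, s')"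

fun parL_map :: "('a, 'b) prog \<Rightarrow> 's + ('a, 'b) prog \<times> 's \<Rightarrow> 's + ('a, 'b) prog \<times> 's" where
  "parL_map Q (Inr (P', s')) = Inr (Par P' Q, s')"
| "parL_map Q (Inl s') = Inr (Q, s')"

fun parR_map :: "('a, 'b) prog \<Rightarrow> 's + ('a, 'b) prog \<times> 's \<Rightarrow> 's + ('a, 'b) prog \<times> 's" where
  "parR_map P (Inr (Q', s')) = Inr (Par P Q', s')"
| "parR_map P (Inl s') = Inr (P, s')"

(* small-step relation, parametrised by [[a]] and [[b]] *)
inductive step :: "('a \<Rightarrow> 's \<Rightarrow> 's dist) \<Rightarrow> ('b \<Rightarrow> 's \<Rightarrow> bool)
    \<Rightarrow> ('a, 'b, 's) conf \<Rightarrow> ('a, 'b, 's) res \<Rightarrow> bool"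
  for sa :: "'a \<Rightarrow> 's \<Rightarrow> 's dist" and sb :: "'b \<Rightarrow> 's \<Rightarrow> bool" where
  atom: "step sa sb (Atom a, s) (embed_state (sa a s))"
| skip: "step sa sb (Skip, s) (point (Inl s))"
| seq: "step sa sb (P, s) \<nu> \<Longrightarrow> step sa sb (Seq P Q, s) (push (seq_map Q) \<nu>)"
| parL: "step sa sb (P, s) \<nu> \<Longrightarrow> step sa sb (Par P Q, s) (push (parL_map Q) \<nu>)"
| parR: "step sa sb (Q, s) \<nu> \<Longrightarrow> step sa sb (Par P Q, s) (push (parR_map P) \<nu>)"
| pchoice: "step sa sb (P, s) \<mu> \<Longrightarrow> step sa sb (Q, s) \<nu> \<Longrightarrow>
     step sa sb (PChoice P p Q, s) (\<lambda>x. real_of_rat p * \<mu> x + (1 - real_of_rat p) * \<nu> x)"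
| nchoiceL: "step sa sb (P, s) \<mu> \<Longrightarrow> step sa sb (NChoice P Q, s) \<mu>"
| nchoiceR: "step sa sb (Q, s) \<mu> \<Longrightarrow> step sa sb (NChoice P Q, s) \<mu>"
| if_tt: "sb b s \<Longrightarrow> step sa sb (If b P Q, s) (point (Inr (P, s)))"
| if_ff: "\<not> sb b s \<Longrightarrow> step sa sb (If b P Q, s) (point (Inr (Q, s)))"
| while_tt: "sb b s \<Longrightarrow> step sa sb (While b P, s) (point (Inr (Seq P (While b P), s)))"
| while_ff: "\<not> sb b s \<Longrightarrow> step sa sb (While b P, s) (point (Inl s))"

(* F_n(P,s); formal sums are read canonically (over the support of nu) *)
fun Fn :: "('a \<Rightarrow> 's \<Rightarrow> 's dist) \<Rightarrow> ('b \<Rightarrow> 's \<Rightarrow> bool) \<Rightarrow> nat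
    \<Rightarrow> ('a, 'b, 's) conf \<Rightarrow> 's dist set" where
  "Fn sa sb 0 c = {zero_dist}"
| "Fn sa sb (Suc n) c =
     {\<mu>. \<exists>\<nu> f. step sa sb c \<nu> \<and>
          (\<forall>c'. \<nu> (Inr c') \<noteq> 0 \<longrightarrow> f c' \<in> Fn sa sb n c') \<and>
          \<mu> = (\<lambda>t. (\<Sum>c'\<in>{c'. \<nu> (Inr c') \<noteq> 0}. \<nu> (Inr c') * f c' t) + \<nu> (Inl t))}"

(* histories and schedulers *)
type_synonym ('a, 'b, 's) hist = "(('a, 'b, 's) conf \<times> ('a, 'b, 's) res) list"
type_synonym ('a, 'b, 's) sched = "('a, 'b, 's) hist \<times> ('a, 'b, 's) conf \<Rightarrow> ('a, 'b, 's) res option"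

definition scheduler :: "('a \<Rightarrow> 's \<Rightarrow> 's dist) \<Rightarrow> ('b \<Rightarrow> 's \<Rightarrow> bool) \<Rightarrow> ('a, 'b, 's) sched \<Rightarrow> bool" where
  "scheduler sa sb Sch \<longleftrightarrow>
     (\<forall>h c d. Sch (h, c) = Some d \<longrightarrow> d \<in> conv {\<nu>. step sa sb c \<nu>})"

(* big-step semantics  h<P,s> \<Down>^{S,n} mu *)
inductive bigstep :: "('a \<Rightarrow> 's \<Rightarrow> 's dist) \<Rightarrow> ('b \<Rightarrow> 's \<Rightarrow> bool) \<Rightarrow> ('a, 'b, 's) sched
    \<Rightarrow> ('a, 'b, 's) hist \<times> ('a, 'b, 's) conf \<Rightarrow> nat \<Rightarrow> 's dist \<Rightarrow> bool"
  for sa :: "'a \<Rightarrow> 's \<Rightarrow> 's dist" and sb :: "'b \<Rightarrow> 's \<Rightarrow> bool"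
  and Sch :: "('a, 'b, 's) sched" where
  zero: "bigstep sa sb Sch (h, c) 0 zero_dist"
| suc: "\<lbrakk> Sch (h, c) = Some (\<lambda>x. \<Sum>k<(m::nat). (p::nat \<Rightarrow> real) k * \<nu> k x);
         \<forall>k<m. 0 \<le> p k; sum p {..<m} = 1;
         \<forall>k<m. step sa sb c (\<nu> k);
         \<forall>k<m. \<forall>c'. \<nu> k (Inr c') \<noteq> 0 \<longrightarrow>
             bigstep sa sb Sch (h @ [(c, \<nu> k)], c') n (\<mu>s k c');
         \<mu> = (\<lambda>t. \<Sum>k<m. p k *
                 ((\<Sum>c'\<in>{c'. \<nu> k (Inr c') \<noteq> 0}. \<nu> k (Inr c') * \<mu>s k c' t) + \<nu> k (Inl t))) \<rbrakk>
       \<Longrightarrow> bigstep sa sb Sch (h, c) (Suc n) \<mu>"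

end

theory Submission
  imports Defs "HOL-Library.Function_Algebras" "HOL-Analysis.Starlike"
begin

text \<open>A step from \<open>c\<close> to \<open>\<nu>\<close> leaves pending configurations \<open>c'\<close> that are continued
independently of each other. The outcome \<open>resolve \<nu> g\<close> is affine in each continuation \<open>g c'\<close>
separately, so taking convex hulls commutes with choosing the continuations. As \<open>Fn (Suc n) c\<close>
is the union over all steps \<open>\<nu>\<close> of the resolvents of \<open>Fn n\<close>, induction on \<open>n\<close> shows that
every big-step outcome lies in the convex hull of \<open>Fn n c\<close>. Conversely, a point of the convex
hull of \<open>Fn (Suc n) c\<close> is a convex combination over finitely many distinct steps \<open>\<nu>\<close> of
resolvents whose continuations lie in the convex hulls of \<open>Fn n\<close>; by induction each
continuation is realised by a scheduler on the subtree below \<open>(c, \<nu>, c')\<close>, and these are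
grafted below a root that plays the combination of the \<open>\<nu>\<close>'s. The steps must be distinct
because a scheduler sees only the history, which records \<open>\<nu>\<close> but not the summand it came
from.\<close>

instantiation "fun" :: (type, real_vector) real_vector
begin
definition scaleR_fun :: "real \<Rightarrow> ('a \<Rightarrow> 'b) \<Rightarrow> 'a \<Rightarrow> 'b" where
  "scaleR_fun r f = (\<lambda>x. r *\<^sub>R f x)"
instance
  by standard (auto simp: scaleR_fun_def fun_eq_iff algebra_simps)
end

lemma scaleR_fun_apply [simp]: "(r *\<^sub>R f) x = r *\<^sub>R f x"
  by (simp add: scaleR_fun_def)

lemma sum_fun_apply [simp]: "(\<Sum>i\<in>I. f i) x = (\<Sum>i\<in>I. f i x)"
  by (induction I rule: infinite_finite_induct) auto

lemma conv_eq_convex_hull: "conv A = convex hull A"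
proof (intro subset_antisym subsetI)
  fix \<mu> assume "\<mu> \<in> conv A"
  then obtain m and p :: "nat \<Rightarrow> real" and x where
    px: "\<forall>i<m. 0 \<le> p i \<and> x i \<in> A" "sum p {..<m} = 1" and "\<mu> = (\<lambda>t. \<Sum>i<m. p i * x i t)"
    unfolding conv_def by blast
  then have "\<mu> = (\<Sum>i<m. p i *\<^sub>R x i)"
    by (simp add: fun_eq_iff)
  also have "\<dots> \<in> convex hull A"
    using px by (intro convex_sum) (auto intro: hull_inc)
  finally show "\<mu> \<in> convex hull A" .
next
  fix \<mu> assume "\<mu> \<in> convex hull A"
  then obtain k u x where ux: "\<forall>i\<in>{1::nat..k}. 0 \<le> u i \<and> x i \<in> A" "sum u {1..k} = 1"
    and \<mu>: "\<mu> = (\<Sum>i = 1..k. u i *\<^sub>R x i)"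
    unfolding convex_hull_indexed by blast
  have shift: "{1..k} = Suc ` {..<k}"
    by (simp add: image_Suc_lessThan)
  show "\<mu> \<in> conv A"
    unfolding conv_def
  proof (intro CollectI exI conjI)
    show "\<forall>i<k. 0 \<le> u (Suc i) \<and> x (Suc i) \<in> A"
      using ux(1) by (auto simp: shift)
    show "(\<Sum>i<k. u (Suc i)) = 1"
      using ux(2) unfolding shift by (simp add: sum.reindex)
    show "\<mu> = (\<lambda>t. \<Sum>i<k. u (Suc i) * x (Suc i) t)"
      unfolding \<mu> shift by (simp add: sum.reindex fun_eq_iff)
  qed
qed

definition resolve :: "('s + 'c) dist \<Rightarrow> ('c \<Rightarrow> 's dist) \<Rightarrow> 's dist" where
  "resolve \<nu> g = (\<lambda>t. (\<Sum>c\<in>{c. \<nu> (Inr c) \<noteq> 0}. \<nu> (Inr c) * g c t) + \<nu> (Inl t))"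

definition resolvents :: "('s + 'c) dist \<Rightarrow> ('c \<Rightarrow> 's dist set) \<Rightarrow> 's dist set" where
  "resolvents \<nu> K = {resolve \<nu> g | g. \<forall>c. \<nu> (Inr c) \<noteq> 0 \<longrightarrow> g c \<in> K c}"

lemma resolve_eq_sum:
  "resolve \<nu> g = (\<lambda>t. \<nu> (Inl t)) + (\<Sum>c\<in>{c. \<nu> (Inr c) \<noteq> 0}. \<nu> (Inr c) *\<^sub>R g c)"
  by (simp add: resolve_def fun_eq_iff)

lemma resolvents_eq_set_sum:
  assumes "finite {c. \<nu> (Inr c) \<noteq> 0}"
  shows "resolvents \<nu> K = {\<lambda>t. \<nu> (Inl t)} + (\<Sum>c\<in>{c. \<nu> (Inr c) \<noteq> 0}. (*\<^sub>R) (\<nu> (Inr c)) ` K c)"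
proof -
  let ?C = "{c. \<nu> (Inr c) \<noteq> 0}"
  have "{sum s ?C | s. \<forall>c\<in>?C. s c \<in> (*\<^sub>R) (\<nu> (Inr c)) ` K c} =
        {\<Sum>c\<in>?C. \<nu> (Inr c) *\<^sub>R g c | g. \<forall>c\<in>?C. g c \<in> K c}"
  proof (intro subset_antisym subsetI)
    fix x assume "x \<in> {sum s ?C | s. \<forall>c\<in>?C. s c \<in> (*\<^sub>R) (\<nu> (Inr c)) ` K c}"
    then obtain s where x: "x = sum s ?C" and "\<forall>c\<in>?C. \<exists>k\<in>K c. s c = \<nu> (Inr c) *\<^sub>R k"
      by blast
    then obtain g where "\<forall>c\<in>?C. g c \<in> K c \<and> s c = \<nu> (Inr c) *\<^sub>R g c"
      by metis
    then show "x \<in> {\<Sum>c\<in>?C. \<nu> (Inr c) *\<^sub>R g c | g. \<forall>c\<in>?C. g c \<in> K c}"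
      unfolding x by (intro CollectI exI[of _ g]) (auto intro: sum.cong)
  qed blast
  then show ?thesis
    unfolding set_sum_alt[OF assms] by (auto simp: resolvents_def resolve_eq_sum set_plus_def)
qed

lemma resolvents_infinite_support:
  assumes "infinite {c. \<nu> (Inr c) \<noteq> 0}"
  shows "resolvents \<nu> K = (if \<forall>c. \<nu> (Inr c) \<noteq> 0 \<longrightarrow> K c \<noteq> {} then {\<lambda>t. \<nu> (Inl t)} else {})"
proof -
  have "resolve \<nu> g = (\<lambda>t. \<nu> (Inl t))" for g
    using assms by (simp add: resolve_def)
  then show ?thesis
    unfolding resolvents_def by (auto simp: ex_in_conv[symmetric]) metis
qed

lemma convex_hull_resolvents: "convex hull (resolvents \<nu> K) = resolvents \<nu> (\<lambda>c. convex hull K c)"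
proof (cases "finite {c. \<nu> (Inr c) \<noteq> 0}")
  case True
  then show ?thesis
    by (simp add: resolvents_eq_set_sum convex_hull_set_plus convex_hull_set_sum convex_hull_scaling)
next
  case False
  then show ?thesis
    by (simp add: resolvents_infinite_support)
qed

lemma convex_hull_UN_convexE:
  fixes S :: "'i \<Rightarrow> 'a::real_vector set"
  assumes "x \<in> convex hull (\<Union>(S ` I))" and "\<And>i. i \<in> I \<Longrightarrow> convex (S i)"
  obtains J c s where "finite J" "J \<subseteq> I" "\<forall>i\<in>J. 0 \<le> c i \<and> s i \<in> S i" "sum c J = 1"
    "x = (\<Sum>i\<in>J. c i *\<^sub>R s i)"
proof -
  obtain T u where T: "finite T" "T \<subseteq> \<Union>(S ` I)" and u: "\<forall>y\<in>T. 0 \<le> u y" "sum u T = 1"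
    and x: "x = (\<Sum>y\<in>T. u y *\<^sub>R y)"
    using assms(1) unfolding convex_hull_explicit by blast
  obtain J0 where J0: "finite J0" "J0 \<subseteq> I" "T \<subseteq> \<Union>(S ` J0)"
    using finite_subset_Union[OF T] finite_subset_image by metis
  define J where "J = {i \<in> J0. S i \<noteq> {}}"
  have "finite J" "J \<subseteq> I"
    using J0 by (auto simp: J_def)
  have "x \<in> convex hull T"
    unfolding x using T(1) u by (intro convex_sum) (auto intro: hull_inc)
  moreover have "T \<subseteq> \<Union>(S ` J)"
    using J0(3) unfolding J_def by blast
  ultimately have "x \<in> convex hull (\<Union>(S ` J))"
    using hull_mono by blast
  moreover have "\<forall>i\<in>J. convex (S i) \<and> S i \<noteq> {}"
    using assms(2) \<open>J \<subseteq> I\<close> by (auto simp: J_def)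
  ultimately obtain c s where "\<forall>i\<in>J. 0 \<le> c i" "sum c J = 1" "\<forall>i\<in>J. s i \<in> S i"
    "x = (\<Sum>i\<in>J. c i *\<^sub>R s i)"
    using convex_hull_finite_union[OF \<open>finite J\<close>] by blast
  with \<open>finite J\<close> \<open>J \<subseteq> I\<close> show thesis
    using that by blast
qed

lemma Fn_Suc_eq: "Fn sa sb (Suc n) c = (\<Union>\<nu>\<in>{\<nu>. step sa sb c \<nu>}. resolvents \<nu> (Fn sa sb n))"
  unfolding resolvents_def resolve_def by auto

lemma bigstep_in_convex_hull_Fn:
  "bigstep sa sb Sch (h, c) n \<mu> \<Longrightarrow> \<mu> \<in> convex hull (Fn sa sb n c)"
proof (induction "(h, c)" n \<mu> arbitrary: h c rule: bigstep.induct)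
  case zero
  then show ?case by simp
next
  case (suc h c p \<nu> m n \<mu>s \<mu>)
  have "resolve (\<nu> k) (\<mu>s k) \<in> convex hull (Fn sa sb (Suc n) c)" if "k < m" for k
  proof -
    have "resolve (\<nu> k) (\<mu>s k) \<in> resolvents (\<nu> k) (\<lambda>c'. convex hull (Fn sa sb n c'))"
      unfolding resolvents_def using suc.hyps \<open>k < m\<close> by auto
    also have "\<dots> = convex hull (resolvents (\<nu> k) (Fn sa sb n))"
      by (rule convex_hull_resolvents[symmetric])
    also have "\<dots> \<subseteq> convex hull (Fn sa sb (Suc n) c)"
      unfolding Fn_Suc_eq using suc.hyps \<open>k < m\<close> by (intro hull_mono) blast
    finally show ?thesis .
  qed
  moreover have "\<mu> = (\<Sum>k<m. p k *\<^sub>R resolve (\<nu> k) (\<mu>s k))"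
    using suc.hyps by (simp add: fun_eq_iff resolve_def)
  ultimately show ?case
    using suc.hyps by (auto intro: convex_sum)
qed

definition descendants ::
  "('a, 'b, 's) hist \<Rightarrow> ('a, 'b, 's) conf \<Rightarrow> (('a, 'b, 's) hist \<times> ('a, 'b, 's) conf) set" where
  "descendants h c = insert (h, c) {(h @ (c, \<nu>) # rest, c') | \<nu> rest c'. True}"

lemma descendants_child_subset: "descendants (h @ [(c, \<nu>)]) c' \<subseteq> descendants h c"
  by (auto simp: descendants_def)

lemma bigstep_cong_descendants:
  assumes "bigstep sa sb Sch (h, c) n \<mu>" and "\<forall>x\<in>descendants h c. Sch' x = Sch x"
  shows "bigstep sa sb Sch' (h, c) n \<mu>"
  using assms
proof (induction "(h, c)" n \<mu> arbitrary: h c rule: bigstep.induct)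
  case zero
  show ?case by (rule bigstep.zero)
next
  case (suc h c p \<nu> m n \<mu>s \<mu>)
  have "Sch' (h, c) = Sch (h, c)"
    using suc.prems by (simp add: descendants_def)
  moreover have "\<forall>k<m. \<forall>c'. \<nu> k (Inr c') \<noteq> 0 \<longrightarrow> bigstep sa sb Sch' (h @ [(c, \<nu> k)], c') n (\<mu>s k c')"
    using suc.hyps suc.prems descendants_child_subset by blast
  ultimately show ?case
    using suc.hyps by (intro bigstep.suc) auto
qed

text \<open>A history below the child \<open>(\<nu>, c')\<close> of \<open>(h, c)\<close> carries \<open>(c, \<nu>)\<close> at position \<open>length h\<close>,
  and \<open>c'\<close> is either its current configuration or the first component of its next entry.\<close>

definition graft :: "('a, 'b, 's) hist \<Rightarrow> ('a, 'b, 's) conf \<Rightarrow> ('a, 'b, 's) res \<Rightarrow>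
    (('a, 'b, 's) res \<Rightarrow> ('a, 'b, 's) conf \<Rightarrow> ('a, 'b, 's) sched) \<Rightarrow> ('a, 'b, 's) sched" where
  "graft h c d F = (\<lambda>(h', c'').
     if (h', c'') = (h, c) then Some d
     else if length h < length h' \<and> take (length h) h' = h \<and> fst (h' ! length h) = c
     then F (snd (h' ! length h))
            (if length h' = Suc (length h) then c'' else fst (h' ! Suc (length h))) (h', c'')
     else None)"

lemma graft_root: "graft h c d F (h, c) = Some d"
  by (simp add: graft_def)

lemma graft_descendant: "x \<in> descendants (h @ [(c, \<nu>)]) c' \<Longrightarrow> graft h c d F x = F \<nu> c' x"
  by (auto simp: descendants_def graft_def nth_append)

lemma scheduler_graft:
  assumes "d \<in> conv {\<nu>. step sa sb c \<nu>}" and "\<And>\<nu> c'. scheduler sa sb (F \<nu> c')"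
  shows "scheduler sa sb (graft h c d F)"
  using assms unfolding scheduler_def graft_def by (auto split: if_splits)

lemma bigstep_SucI:
  assumes "finite V" and "Sch (h, c) = Some (\<Sum>\<nu>\<in>V. p \<nu> *\<^sub>R \<nu>)"
    and "\<forall>\<nu>\<in>V. 0 \<le> p \<nu> \<and> step sa sb c \<nu>" and "sum p V = 1"
    and "\<forall>\<nu>\<in>V. \<forall>c'. \<nu> (Inr c') \<noteq> 0 \<longrightarrow> bigstep sa sb Sch (h @ [(c, \<nu>)], c') n (\<mu>s \<nu> c')"
  shows "bigstep sa sb Sch (h, c) (Suc n) (\<Sum>\<nu>\<in>V. p \<nu> *\<^sub>R resolve \<nu> (\<mu>s \<nu>))"
proof -
  obtain e where e: "bij_betw e {..<card V} V"
    using ex_bij_betw_nat_finite[OF assms(1)] by (metis lessThan_atLeast0)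
  have reindex: "(\<Sum>\<nu>\<in>V. f \<nu>) = (\<Sum>k<card V. f (e k))" for f :: "_ \<Rightarrow> 'z::comm_monoid_add"
    using sum.reindex_bij_betw[OF e, of f] by simp
  have eV: "e k \<in> V" if "k < card V" for k
    using bij_betwE[OF e] that by blast
  show ?thesis
  proof (rule bigstep.suc[where m = "card V" and p = "p \<circ> e" and \<nu> = e and \<mu>s = "\<mu>s \<circ> e"])
    show "Sch (h, c) = Some (\<lambda>x. \<Sum>k<card V. (p \<circ> e) k * e k x)"
      using assms(2) by (simp add: reindex fun_eq_iff)
    show "sum (p \<circ> e) {..<card V} = 1"
      using assms(4) by (simp add: reindex)
    show "(\<Sum>\<nu>\<in>V. p \<nu> *\<^sub>R resolve \<nu> (\<mu>s \<nu>)) = (\<lambda>t. \<Sum>k<card V. (p \<circ> e) k *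
        ((\<Sum>c'\<in>{c'. e k (Inr c') \<noteq> 0}. e k (Inr c') * (\<mu>s \<circ> e) k c' t) + e k (Inl t)))"
      by (simp add: reindex fun_eq_iff resolve_def)
  qed (use assms(3,5) eV in auto)
qed

lemma bigstep_graft:
  assumes "finite V" and "\<forall>\<nu>\<in>V. 0 \<le> p \<nu> \<and> step sa sb c \<nu>" and "sum p V = 1"
    and "\<forall>\<nu>\<in>V. \<forall>c'. \<nu> (Inr c') \<noteq> 0 \<longrightarrow> bigstep sa sb (F \<nu> c') (h @ [(c, \<nu>)], c') n (G \<nu> c')"
  shows "bigstep sa sb (graft h c (\<Sum>\<nu>\<in>V. p \<nu> *\<^sub>R \<nu>) F) (h, c) (Suc n)
           (\<Sum>\<nu>\<in>V. p \<nu> *\<^sub>R resolve \<nu> (G \<nu>))"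
proof (rule bigstep_SucI)
  show "\<forall>\<nu>\<in>V. \<forall>c'. \<nu> (Inr c') \<noteq> 0 \<longrightarrow>
      bigstep sa sb (graft h c (\<Sum>\<nu>\<in>V. p \<nu> *\<^sub>R \<nu>) F) (h @ [(c, \<nu>)], c') n (G \<nu> c')"
  proof (intro ballI allI impI)
    fix \<nu> c' assume "\<nu> \<in> V" and "\<nu> (Inr c') \<noteq> 0"
    with assms(4) have "bigstep sa sb (F \<nu> c') (h @ [(c, \<nu>)], c') n (G \<nu> c')"
      by blast
    then show "bigstep sa sb (graft h c (\<Sum>\<nu>\<in>V. p \<nu> *\<^sub>R \<nu>) F) (h @ [(c, \<nu>)], c') n (G \<nu> c')"
      by (rule bigstep_cong_descendants) (simp add: graft_descendant)
  qed
qed (use assms(1-3) in \<open>simp_all add: graft_root\<close>)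

lemma convex_hull_Fn_SucE:
  assumes "\<mu> \<in> convex hull (Fn sa sb (Suc n) c)"
  obtains V p G where "finite V" "\<forall>\<nu>\<in>V. 0 \<le> p \<nu> \<and> step sa sb c \<nu>" "sum p V = 1"
    "\<forall>\<nu>\<in>V. \<forall>c'. \<nu> (Inr c') \<noteq> 0 \<longrightarrow> G \<nu> c' \<in> convex hull (Fn sa sb n c')"
    "\<mu> = (\<Sum>\<nu>\<in>V. p \<nu> *\<^sub>R resolve \<nu> (G \<nu>))"
proof -
  have "\<mu> \<in> convex hull (\<Union>\<nu>\<in>{\<nu>. step sa sb c \<nu>}. convex hull (resolvents \<nu> (Fn sa sb n)))"
    using assms unfolding Fn_Suc_eq by (rule rev_subsetD) (intro hull_mono UN_mono hull_subset order.refl)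
  then obtain V p y where V: "finite V" "V \<subseteq> {\<nu>. step sa sb c \<nu>}" "sum p V = 1"
    and py: "\<forall>\<nu>\<in>V. 0 \<le> p \<nu> \<and> y \<nu> \<in> convex hull (resolvents \<nu> (Fn sa sb n))"
    and \<mu>: "\<mu> = (\<Sum>\<nu>\<in>V. p \<nu> *\<^sub>R y \<nu>)"
    by (rule convex_hull_UN_convexE) auto
  have "\<forall>\<nu>\<in>V. \<exists>g. y \<nu> = resolve \<nu> g \<and>
      (\<forall>c'. \<nu> (Inr c') \<noteq> 0 \<longrightarrow> g c' \<in> convex hull (Fn sa sb n c'))"
    using py unfolding convex_hull_resolvents unfolding resolvents_def by blast
  then obtain G where G: "\<forall>\<nu>\<in>V. y \<nu> = resolve \<nu> (G \<nu>) \<and>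
      (\<forall>c'. \<nu> (Inr c') \<noteq> 0 \<longrightarrow> G \<nu> c' \<in> convex hull (Fn sa sb n c'))"
    by (auto dest!: bchoice)
  have "\<mu> = (\<Sum>\<nu>\<in>V. p \<nu> *\<^sub>R resolve \<nu> (G \<nu>))"
    unfolding \<mu> using G by (intro sum.cong) auto
  with V py G show thesis
    using that by blast
qed

lemma scheduler_None: "scheduler sa sb (\<lambda>_. None)"
  by (simp add: scheduler_def)

lemma convex_hull_Fn_imp_bigstep:
  "\<mu> \<in> convex hull (Fn sa sb n c) \<Longrightarrow> \<exists>Sch. scheduler sa sb Sch \<and> bigstep sa sb Sch (h, c) n \<mu>"
proof (induction n arbitrary: h c \<mu>)
  case 0
  then show ?case
    by (auto intro: bigstep.zero scheduler_None)
next
  case (Suc n)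
  then obtain V p G where V: "finite V" "\<forall>\<nu>\<in>V. 0 \<le> p \<nu> \<and> step sa sb c \<nu>" "sum p V = 1"
    and G: "\<forall>\<nu>\<in>V. \<forall>c'. \<nu> (Inr c') \<noteq> 0 \<longrightarrow> G \<nu> c' \<in> convex hull (Fn sa sb n c')"
    and \<mu>: "\<mu> = (\<Sum>\<nu>\<in>V. p \<nu> *\<^sub>R resolve \<nu> (G \<nu>))"
    by (elim convex_hull_Fn_SucE)
  have "\<exists>S. scheduler sa sb S \<and>
      (\<nu> \<in> V \<and> \<nu> (Inr c') \<noteq> 0 \<longrightarrow> bigstep sa sb S (h @ [(c, \<nu>)], c') n (G \<nu> c'))" for \<nu> c'
  proof (cases "\<nu> \<in> V \<and> \<nu> (Inr c') \<noteq> 0")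
    case True
    then show ?thesis
      using Suc.IH G by blast
  qed (auto intro: scheduler_None)
  then obtain F where F: "\<And>\<nu> c'. scheduler sa sb (F \<nu> c') \<and>
      (\<nu> \<in> V \<and> \<nu> (Inr c') \<noteq> 0 \<longrightarrow> bigstep sa sb (F \<nu> c') (h @ [(c, \<nu>)], c') n (G \<nu> c'))"
    by metis
  define d where "d = (\<Sum>\<nu>\<in>V. p \<nu> *\<^sub>R \<nu>)"
  have "d \<in> conv {\<nu>. step sa sb c \<nu>}"
    unfolding d_def conv_eq_convex_hull using V by (intro convex_sum) (auto intro: hull_inc)
  then have "scheduler sa sb (graft h c d F)"
    using F by (intro scheduler_graft) auto
  moreover have "bigstep sa sb (graft h c d F) (h, c) (Suc n) \<mu>"
    unfolding d_def \<mu> using V F by (auto intro!: bigstep_graft)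
  ultimately show ?case by blast
qed

theorem theorem5:
  fixes sa :: "'a \<Rightarrow> 's \<Rightarrow> 's dist" and sb :: "'b \<Rightarrow> 's \<Rightarrow> bool"
    and P :: "('a, 'b) prog" and s :: 's and n :: nat
  assumes "\<forall>a t. is_dist (sa a t)"
    and "wf_prog P"
  shows "conv (Fn sa sb n (P, s)) =
         {\<mu>. \<exists>Sch. scheduler sa sb Sch \<and> bigstep sa sb Sch ([], (P, s)) n \<mu>}"
  unfolding conv_eq_convex_hull
  using convex_hull_Fn_imp_bigstep bigstep_in_convex_hull_Fn by blast

end
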